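(* Let $G$ be a finite simple connected graph with $m\geq 1$ edges and maximum degree $\Delta$. If $G\ncong K_2$, then $$SDD(\mathcal{L}(G))>\frac{\Delta^{3}\left(M_{1}(G)-2m\right)^{2}}{(\Delta-1)^{3}\chi_{3}(G)}.$$
   Context: For a finite simple graph $H$ with vertex set $V_H$ and edge set $E_H$, $d_u$ denotes the degree of vertex $u$ in $H$; the symmetric division deg index is $SDD(H)=\sum_{uv\in E_H}\left(\frac{d_u}{d_v}+\frac{d_v}{d_u}\right)$, the first Zagreb index is $M_1(H)=\sum_{u\in V_H}d_u^2$, and the general sum-connectivity index with exponent $3$ is $\chi_3(H)=\sum_{uv\in E_H}(d_u+d_v)^3$. The line graph $\mathcal{L}(G)$ has vertex set $E_G$, two vertices being adjacent when the corresponding edges of $G$ share a common endpoint. *)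

theory Defs
  imports Complex_Main
begin

record 'v ugraph =
  verts :: "'v set"
  edges :: "'v set set"

definition simple_graph :: "'v ugraph \<Rightarrow> bool" where
  "simple_graph G \<longleftrightarrow> finite (verts G) \<and> (\<forall>e \<in> edges G. e \<subseteq> verts G \<and> card e = 2)"

definition adjacency :: "'v ugraph \<Rightarrow> ('v \<times> 'v) set" where
  "adjacency G = {(u, v). {u, v} \<in> edges G}"

definition connected_graph :: "'v ugraph \<Rightarrow> bool" where
  "connected_graph G \<longleftrightarrow>
     verts G \<noteq> {} \<and> (\<forall>u \<in> verts G. \<forall>v \<in> verts G. (u, v) \<in> (adjacency G)\<^sup>*)"

definition graph_iso :: "'v ugraph \<Rightarrow> 'w ugraph \<Rightarrow> bool" where
  "graph_iso G H \<longleftrightarrow>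
     (\<exists>f. bij_betw f (verts G) (verts H) \<and>
          (\<forall>u \<in> verts G. \<forall>v \<in> verts G. {u, v} \<in> edges G \<longleftrightarrow> {f u, f v} \<in> edges H))"

definition complete_graph :: "nat \<Rightarrow> nat ugraph" where
  "complete_graph n =
     \<lparr>verts = {..<n}, edges = {{i, j} | i j. i < n \<and> j < n \<and> i \<noteq> j}\<rparr>"

definition degree :: "'v ugraph \<Rightarrow> 'v \<Rightarrow> nat" where
  "degree G u = card {v \<in> verts G. {u, v} \<in> edges G}"

definition max_degree :: "'v ugraph \<Rightarrow> nat" where
  "max_degree G = Max (degree G ` verts G)"

text \<open>The sum of \<open>F u v\<close> over the unordered edges \<open>{u, v}\<close>, each edge counted once.
  It is only meaningful for symmetric \<open>F\<close>, where the summand does not depend on which endpoint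
  is called \<open>u\<close>; see \<open>edge_value\<close>.\<close>
definition edge_sum :: "'v ugraph \<Rightarrow> ('v \<Rightarrow> 'v \<Rightarrow> real) \<Rightarrow> real" where
  "edge_sum G F = (\<Sum>e \<in> edges G. THE r. \<exists>u v. e = {u, v} \<and> r = F u v)"

lemma edge_value:
  assumes "\<And>x y. F x y = F y x"
  shows "(THE r. \<exists>x y. {u, v} = {x, y} \<and> r = F x y) = F u v"
  by (rule the_equality) (use assms in \<open>auto simp: doubleton_eq_iff\<close>)

definition SDD :: "'v ugraph \<Rightarrow> real" where
  "SDD H = edge_sum H (\<lambda>u v. real (degree H u) / real (degree H v)
                            + real (degree H v) / real (degree H u))"

definition M1 :: "'v ugraph \<Rightarrow> real" where
  "M1 H = (\<Sum>u \<in> verts H. (real (degree H u))\<^sup>2)"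

definition chi3 :: "'v ugraph \<Rightarrow> real" where
  "chi3 H = edge_sum H (\<lambda>u v. (real (degree H u) + real (degree H v)) ^ 3)"

definition line_graph :: "'v ugraph \<Rightarrow> 'v set ugraph" where
  "line_graph G =
     \<lparr>verts = edges G,
      edges = {{e, f} | e f. e \<in> edges G \<and> f \<in> edges G \<and> e \<noteq> f \<and> e \<inter> f \<noteq> {}}\<rparr>"

end

theory Submission
  imports Defs
begin

text \<open>Every summand of \<open>SDD (line_graph G)\<close> is at least 2, and by the handshake lemma twice the
  number of edges of the line graph is the sum of \<open>s - 2\<close> over the edges \<open>uv\<close> of \<open>G\<close>, where
  \<open>s = d\<^sub>u + d\<^sub>v\<close>. That sum equals \<open>M1 G - 2 * m\<close>, so \<open>SDD (line_graph G) \<ge> M1 G - 2 * m\<close>.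
  It remains to see that \<open>\<Delta>\<^sup>3 (M1 G - 2 * m) < (\<Delta> - 1)\<^sup>3 \<chi>\<^sub>3(G)\<close>. Since \<open>G\<close> is not \<open>K\<^sub>2\<close>,
  \<open>\<Delta> \<ge> 2\<close> and hence \<open>\<Delta>\<^sup>3 \<le> 8 (\<Delta> - 1)\<^sup>3\<close>; and \<open>\<chi>\<^sub>3(G)\<close> is the sum of \<open>s\<^sup>3\<close> over the
  edges, where \<open>8 (s - 2) < s\<^sup>3\<close>.\<close>

section \<open>Simple graphs and their line graphs\<close>

lemma simple_graph_edge_subset:
  assumes "simple_graph G" "e \<in> edges G"
  shows "e \<subseteq> verts G"
  using assms by (simp add: simple_graph_def)

lemma simple_graph_finite:
  assumes "simple_graph G"
  shows "finite (verts G)" "finite (edges G)"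
proof -
  show fin: "finite (verts G)" using assms by (simp add: simple_graph_def)
  have "edges G \<subseteq> Pow (verts G)" using simple_graph_edge_subset[OF assms] by blast
  then show "finite (edges G)" by (rule finite_subset) (simp add: fin)
qed

lemma simple_graph_edgeE:
  assumes "simple_graph G" "e \<in> edges G"
  obtains u v where "e = {u, v}" "u \<noteq> v" "u \<in> verts G" "v \<in> verts G"
proof -
  have "card e = 2" using assms by (simp add: simple_graph_def)
  then obtain u v where "e = {u, v}" "u \<noteq> v" unfolding card_2_iff by blast
  then show thesis using that simple_graph_edge_subset[OF assms] by simp
qed

lemma doubleton_mem_edges_line_graph:
  \<comment> \<open>The adjacency condition is symmetric in \<open>e\<close> and \<open>f\<close>,
    so it does not matter in which order the set comprehension lists the pair.\<close>
  "{e, f} \<in> edges (line_graph G) \<longleftrightarrow> e \<in> edges G \<and> f \<in> edges G \<and> e \<noteq> f \<and> e \<inter> f \<noteq> {}"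
  unfolding line_graph_def ugraph.simps mem_Collect_eq doubleton_eq_iff by blast

lemma verts_line_graph [simp]: "verts (line_graph G) = edges G"
  by (simp add: line_graph_def)

lemma simple_graph_line_graph:
  assumes "simple_graph G"
  shows "simple_graph (line_graph G)"
  unfolding simple_graph_def
proof (intro conjI ballI)
  show "finite (verts (line_graph G))" using simple_graph_finite(2)[OF assms] by simp
  fix P assume "P \<in> edges (line_graph G)"
  then obtain e f where "P = {e, f}" "e \<in> edges G" "f \<in> edges G" "e \<noteq> f"
    unfolding line_graph_def ugraph.simps by blast
  then show "P \<subseteq> verts (line_graph G)" "card P = 2" by simp_all
qed

section \<open>Double counting of incidences\<close>

lemma card_incident_edges:
  assumes "simple_graph G"
  shows "card {e \<in> edges G. v \<in> e} = degree G v"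
  unfolding degree_def
proof (rule bij_betw_same_card[symmetric], rule bij_betw_imageI)
  show "inj_on (\<lambda>w. {v, w}) {w \<in> verts G. {v, w} \<in> edges G}"
    by (simp add: inj_on_def doubleton_eq_iff)
  show "(\<lambda>w. {v, w}) ` {w \<in> verts G. {v, w} \<in> edges G} = {e \<in> edges G. v \<in> e}"
  proof (intro equalityI subsetI)
    fix e assume e: "e \<in> {e \<in> edges G. v \<in> e}"
    then have "e \<in> edges G" by simp
    with assms obtain a b where ab: "e = {a, b}" "a \<in> verts G" "b \<in> verts G"
      by (rule simple_graph_edgeE)
    then obtain w where "w \<in> verts G" "e = {v, w}" using e by blast
    then show "e \<in> (\<lambda>w. {v, w}) ` {w \<in> verts G. {v, w} \<in> edges G}" using e by simp
  qed blast
qed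

text \<open>Both sides sum \<open>g v\<close> over all incident pairs of a vertex \<open>v\<close>
  and an edge \<open>e\<close>. With \<open>g = 1\<close> this is the handshake lemma; with
  \<open>g\<close> the degree it turns \<open>M1\<close> into a sum over edges.\<close>

lemma sum_degree_mult:
  fixes g :: "'v \<Rightarrow> real"
  assumes "simple_graph G"
  shows "(\<Sum>v\<in>verts G. real (degree G v) * g v) = (\<Sum>e\<in>edges G. \<Sum>v\<in>e. g v)"
proof -
  have "(\<Sum>v\<in>verts G. real (degree G v) * g v)
      = (\<Sum>v\<in>verts G. \<Sum>e | e \<in> edges G \<and> v \<in> e. g v)"
    by (simp add: card_incident_edges[OF assms])
  also have "\<dots> = (\<Sum>e\<in>edges G. \<Sum>v | v \<in> verts G \<and> v \<in> e. g v)"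
    by (rule sum.swap_restrict[OF simple_graph_finite[OF assms]])
  also have "\<dots> = (\<Sum>e\<in>edges G. \<Sum>v\<in>e. g v)"
    by (intro sum.cong refl) (use simple_graph_edge_subset[OF assms] in blast)
  finally show ?thesis .
qed

lemma sum_degree:
  assumes "simple_graph G"
  shows "(\<Sum>v\<in>verts G. real (degree G v)) = 2 * real (card (edges G))"
proof -
  have "(\<Sum>e\<in>edges G. \<Sum>v\<in>e. 1::real) = (\<Sum>e\<in>edges G. 2)"
    by (rule sum.cong) (use assms in \<open>simp_all add: simple_graph_def\<close>)
  then show ?thesis using sum_degree_mult[OF assms, of "\<lambda>_. 1"] by simp
qed

lemma M1_minus_edges_eq:
  assumes "simple_graph G"
  shows "M1 G - 2 * real (card (edges G)) = (\<Sum>e\<in>edges G. (\<Sum>v\<in>e. real (degree G v)) - 2)"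
  unfolding M1_def power2_eq_square sum_degree_mult[OF assms] sum_subtractf sum_constant
  by (simp only: mult.commute)

text \<open>An edge has two distinct endpoints, so summing the degree over its elements gives
  \<open>d\<^sub>u + d\<^sub>v\<close> without naming the endpoints or using
  \<open>THE\<close>.\<close>

lemma chi3_eq:
  assumes "simple_graph G"
  shows "chi3 G = (\<Sum>e\<in>edges G. (\<Sum>v\<in>e. real (degree G v)) ^ 3)"
  unfolding chi3_def edge_sum_def
proof (intro sum.cong refl)
  fix e assume "e \<in> edges G"
  with assms obtain u v where e: "e = {u, v}" "u \<noteq> v" by (rule simple_graph_edgeE)
  show "(THE r. \<exists>u v. e = {u, v} \<and> r = (real (degree G u) + real (degree G v)) ^ 3)
      = (\<Sum>v\<in>e. real (degree G v)) ^ 3"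
    unfolding e(1) by (subst edge_value) (simp_all add: e(2) add.commute)
qed

text \<open>Only \<open>e\<close> contains both of its endpoints, so by inclusion-exclusion
  \<open>d\<^sub>u + d\<^sub>v - 1\<close> edges meet \<open>e\<close>, among them \<open>e\<close>
  itself. Stated over the reals, the subtraction is not truncated.\<close>

lemma degree_line_graph:
  assumes simple: "simple_graph G" and e: "e \<in> edges G"
  shows "real (degree (line_graph G) e) = (\<Sum>v\<in>e. real (degree G v)) - 2"
proof -
  let ?I = "\<lambda>v. {f \<in> edges G. v \<in> f}"
  have fin: "finite (?I v)" for v using simple_graph_finite(2)[OF simple] by simp
  from assms obtain u v where uv: "e = {u, v}" "u \<noteq> v" by (rule simple_graph_edgeE)
  have "f = e" if "f \<in> edges G" "u \<in> f" "v \<in> f" for f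
  proof -
    from simple that(1) obtain a b where "f = {a, b}" by (rule simple_graph_edgeE)
    with that uv show ?thesis by blast
  qed
  then have common: "?I u \<inter> ?I v = {e}" using e uv(1) by blast
  have "card (?I u \<union> ?I v) + 1 = degree G u + degree G v"
    using card_Un_Int[OF fin fin, of u v] unfolding common card_incident_edges[OF simple] by simp
  moreover have "degree (line_graph G) e = card (?I u \<union> ?I v - {e})"
    unfolding degree_def verts_line_graph doubleton_mem_edges_line_graph
    by (rule arg_cong[where f = card]) (use e uv(1) in blast)
  moreover have "card (?I u \<union> ?I v) = Suc (card (?I u \<union> ?I v - {e}))"
    by (rule card.remove) (use fin e uv(1) in simp_all)
  ultimately have "real (degree (line_graph G) e) + 2 = real (degree G u) + real (degree G v)"
    by linarith
  then show ?thesis unfolding uv(1) using uv(2) by simp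
qed

section \<open>Lower bound for the symmetric division deg index\<close>

lemma two_le_add_inverse:
  fixes x y :: real
  assumes "x > 0" "y > 0"
  shows "2 \<le> x / y + y / x"
proof -
  have "0 \<le> (x - y)\<^sup>2 / (x * y)" using assms by simp
  also have "\<dots> = x / y + y / x - 2"
    using assms by (simp add: field_simps power2_eq_square)
  finally show ?thesis by simp
qed

lemma degree_pos:
  assumes "simple_graph G" "{u, v} \<in> edges G"
  shows "degree G u > 0"
proof -
  have "v \<in> {w \<in> verts G. {u, w} \<in> edges G}"
    using simple_graph_edge_subset[OF assms] assms(2) by simp
  moreover have "finite {w \<in> verts G. {u, w} \<in> edges G}"
    using simple_graph_finite(1)[OF assms(1)] by simp
  ultimately show ?thesis unfolding degree_def card_gt_0_iff by blast
qed

lemma SDD_ge_twice_card_edges: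
  assumes "simple_graph H"
  shows "SDD H \<ge> 2 * real (card (edges H))"
proof -
  let ?F = "\<lambda>u v. real (degree H u) / real (degree H v) + real (degree H v) / real (degree H u)"
  have "(\<Sum>e\<in>edges H. 2) \<le> SDD H"
    unfolding SDD_def edge_sum_def
  proof (rule sum_mono)
    fix e assume edge: "e \<in> edges H"
    with assms obtain u v where e: "e = {u, v}" by (rule simple_graph_edgeE)
    \<comment> \<open>Positivity matters: since \<open>x / 0 = 0\<close>, a zero degree would make
      the summand 0.\<close>
    have "degree H u > 0" "degree H v > 0"
      using edge degree_pos[OF assms, of u v] degree_pos[OF assms, of v u]
      by (simp_all add: e insert_commute)
    then have "2 \<le> ?F u v" by (intro two_le_add_inverse) simp_all
    also have "?F u v = (THE r. \<exists>u v. e = {u, v} \<and> r = ?F u v)"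
      unfolding e by (rule edge_value[symmetric]) (rule add.commute)
    finally show "2 \<le> (THE r. \<exists>u v. e = {u, v} \<and> r = ?F u v)" .
  qed
  then show ?thesis by simp
qed

lemma M1_minus_edges_eq_sum_degree_line_graph:
  assumes "simple_graph G"
  shows "M1 G - 2 * real (card (edges G)) = (\<Sum>e\<in>edges G. real (degree (line_graph G) e))"
  unfolding M1_minus_edges_eq[OF assms]
  by (rule sum.cong) (simp_all only: degree_line_graph[OF assms])

lemma SDD_line_graph_ge:
  assumes "simple_graph G"
  shows "SDD (line_graph G) \<ge> M1 G - 2 * real (card (edges G))"
  using SDD_ge_twice_card_edges[OF simple_graph_line_graph[OF assms]]
    sum_degree[OF simple_graph_line_graph[OF assms]]
  by (simp only: M1_minus_edges_eq_sum_degree_line_graph[OF assms] verts_line_graph)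

text \<open>An edge \<open>{w, x}\<close> at \<open>w\<close> has degree at least
  \<open>2 + 1 - 2 = 1\<close> in the line graph, so the degree sum there is positive.\<close>

lemma M1_minus_edges_pos:
  assumes simple: "simple_graph G" and w: "degree G w \<ge> 2"
  shows "M1 G - 2 * real (card (edges G)) > 0"
  unfolding M1_minus_edges_eq_sum_degree_line_graph[OF simple]
proof -
  have "{x \<in> verts G. {w, x} \<in> edges G} \<noteq> {}"
    using w unfolding degree_def by (intro notI) simp
  then obtain x where x: "{w, x} \<in> edges G" by blast
  then have "w \<noteq> x" using simple by (auto simp: simple_graph_def)
  moreover have "degree G x > 0" using degree_pos[OF simple, of x w] x by (simp only: insert_commute)
  ultimately have "0 < real (degree (line_graph G) {w, x})"
    unfolding degree_line_graph[OF simple x] using w by simp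
  with simple_graph_finite(2)[OF simple] x
  show "0 < (\<Sum>e\<in>edges G. real (degree (line_graph G) e))" by (rule sum_pos2) simp
qed

section \<open>Lower bound for the sum-connectivity index\<close>

lemma cube_gt:
  fixes s :: real
  assumes "s \<ge> 0"
  shows "8 * (s - 2) < s ^ 3"
proof (cases "s = 0")
  case False
  \<comment> \<open>The tangent to \<open>s ^ 3\<close> at 2 is \<open>12 * s - 16\<close>, with
    remainder \<open>(s - 2)\<^sup>2 * (s + 4)\<close>; the line \<open>8 * (s - 2)\<close> lies
    \<open>4 * s\<close> below it.\<close>
  have "0 < (s - 2)\<^sup>2 * (s + 4) + 4 * s"
    using assms False by (intro add_nonneg_pos mult_nonneg_nonneg) simp_all
  also have "\<dots> = s ^ 3 - 8 * (s - 2)"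
    by (simp add: power2_eq_square power3_eq_cube algebra_simps)
  finally show ?thesis by simp
qed simp

lemma chi3_gt:
  assumes "simple_graph G" "edges G \<noteq> {}"
  shows "8 * (M1 G - 2 * real (card (edges G))) < chi3 G"
  unfolding M1_minus_edges_eq[OF assms(1)] chi3_eq[OF assms(1)] sum_distrib_left
  by (intro sum_strict_mono cube_gt sum_nonneg simple_graph_finite assms) simp

lemma graph_iso_complete_graph_2:
  assumes simple: "simple_graph G" and uv: "{u, v} \<in> edges G" and verts: "verts G = {u, v}"
  shows "graph_iso G (complete_graph 2)"
  unfolding graph_iso_def
proof (intro exI conjI)
  \<comment> \<open>For \<open>a = b\<close> the pair \<open>{a, b}\<close> collapses to a
    singleton, which must be a non-edge.\<close>
  have no_loop: "{w} \<notin> edges G" for w using simple by (auto simp: simple_graph_def)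
  then have "u \<noteq> v" using uv by auto
  let ?f = "\<lambda>w. if w = u then 0 else 1 :: nat"
  show "bij_betw ?f (verts G) (verts (complete_graph 2))"
    using \<open>u \<noteq> v\<close> by (simp add: verts bij_betw_def complete_graph_def numeral_2_eq_2 lessThan_Suc insert_commute)
  have "edges (complete_graph 2) = {{0, 1}}"
    by (auto simp: complete_graph_def less_2_cases_iff)
  then show "\<forall>a\<in>verts G. \<forall>b\<in>verts G.
      {a, b} \<in> edges G \<longleftrightarrow> {?f a, ?f b} \<in> edges (complete_graph 2)"
    using uv no_loop \<open>u \<noteq> v\<close> by (simp add: verts insert_commute)
qed

text \<open>If all degrees were at most 1, the endpoints of an edge would have no other neighbours,
  so by connectedness they would be the whole graph.\<close>

lemma two_le_max_degree:
  assumes simple: "simple_graph G" and conn: "connected_graph G"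
    and "edges G \<noteq> {}" and "\<not> graph_iso G (complete_graph 2)"
  shows "max_degree G \<ge> 2"
proof (rule ccontr)
  assume less: "\<not> max_degree G \<ge> 2"
  have unique: "b = c" if "{a, b} \<in> edges G" "{a, c} \<in> edges G" for a b c
  proof -
    let ?N = "{w \<in> verts G. {a, w} \<in> edges G}"
    have verts: "a \<in> verts G" "b \<in> verts G" "c \<in> verts G"
      using that[THEN simple_graph_edge_subset[OF simple]] by simp_all
    have "degree G a \<le> max_degree G"
      unfolding max_degree_def using simple_graph_finite(1)[OF simple] verts(1) by simp
    then have "card ?N \<le> Suc 0" using less unfolding degree_def by linarith
    moreover have "finite ?N" using simple_graph_finite(1)[OF simple] by simp
    moreover have "b \<in> ?N" "c \<in> ?N" using that verts by simp_all
    ultimately show ?thesis unfolding card_le_Suc0_iff_eq[OF \<open>finite ?N\<close>] by blast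
  qed
  obtain e where e: "e \<in> edges G" using assms(3) by blast
  with simple obtain u v where "e = {u, v}" "u \<in> verts G" "v \<in> verts G"
    by (rule simple_graph_edgeE)
  with e have uv: "{u, v} \<in> edges G" "u \<in> verts G" "v \<in> verts G" by simp_all
  then have vu: "{v, u} \<in> edges G" by (simp only: insert_commute)
  \<comment> \<open>By \<open>unique\<close>, a walk from \<open>u\<close> can only alternate
    between \<open>u\<close> and \<open>v\<close>.\<close>
  have reach: "w \<in> {u, v}" if "(u, w) \<in> (adjacency G)\<^sup>*" for w
    using that
  proof (induction rule: rtrancl_induct)
    case (step y z)
    then have "{y, z} \<in> edges G" by (simp add: adjacency_def)
    with step.IH uv(1) vu show ?case using unique by blast
  qed simp
  have "verts G = {u, v}" using conn uv(2,3) reach unfolding connected_graph_def by blast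
  then show False using graph_iso_complete_graph_2[OF simple uv(1)] assms(4) by simp
qed

theorem theorem4p6:
  fixes G :: "'v ugraph" and m \<Delta> :: nat
  assumes "simple_graph G"
    and "connected_graph G"
    and "m = card (edges G)"
    and "m \<ge> 1"
    and "\<Delta> = max_degree G"
    and "\<not> graph_iso G (complete_graph 2)"
  shows "SDD (line_graph G) >
    (real \<Delta> ^ 3 * (M1 G - 2 * real m)\<^sup>2) / ((real \<Delta> - 1) ^ 3 * chi3 G)"
proof -
  note simple = assms(1)
  let ?N = "M1 G - 2 * real m"
  have nonempty: "edges G \<noteq> {}" using assms(3,4) by (intro notI) simp
  have \<Delta>: "\<Delta> \<ge> 2"
    unfolding assms(5) by (rule two_le_max_degree[OF simple assms(2) nonempty assms(6)])
  have "max_degree G \<in> degree G ` verts G"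
    unfolding max_degree_def using simple_graph_finite(1)[OF simple] assms(2)
    by (intro Max_in) (simp_all add: connected_graph_def)
  then obtain w where "max_degree G = degree G w" by (rule imageE)
  then have "degree G w \<ge> 2" using \<Delta> assms(5) by simp
  then have N_pos: "?N > 0" unfolding assms(3) by (rule M1_minus_edges_pos[OF simple])
  have chi3_gt: "8 * ?N < chi3 G" unfolding assms(3) by (rule chi3_gt[OF simple nonempty])
  \<comment> \<open>The factor \<open>2 ^ 3\<close> arising here is absorbed by the 8 in
    \<open>chi3_gt\<close>.\<close>
  have "real \<Delta> ^ 3 \<le> (2 * (real \<Delta> - 1)) ^ 3" using \<Delta> by (intro power_mono) simp_all
  then have "real \<Delta> ^ 3 \<le> (real \<Delta> - 1) ^ 3 * 8" unfolding power_mult_distrib by simp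
  then have "real \<Delta> ^ 3 * ?N \<le> (real \<Delta> - 1) ^ 3 * 8 * ?N"
    using N_pos by (intro mult_right_mono) linarith+
  also have "\<dots> < (real \<Delta> - 1) ^ 3 * chi3 G"
    unfolding mult.assoc using chi3_gt \<Delta> by (intro mult_strict_left_mono zero_less_power) simp_all
  finally have key: "real \<Delta> ^ 3 * ?N < (real \<Delta> - 1) ^ 3 * chi3 G" .
  have "0 < 8 * ?N" using N_pos by simp
  also note chi3_gt
  finally have denom: "(real \<Delta> - 1) ^ 3 * chi3 G > 0"
    using \<Delta> by (intro mult_pos_pos zero_less_power) simp_all
  \<comment> \<open>A second factor \<open>?N\<close> produces the square; dividing by the positive
    denominator then leaves \<open>?N\<close> as the upper bound.\<close>
  have "real \<Delta> ^ 3 * ?N\<^sup>2 < ?N * ((real \<Delta> - 1) ^ 3 * chi3 G)"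
    using mult_strict_left_mono[OF key N_pos] by (simp only: power2_eq_square mult_ac)
  then have "real \<Delta> ^ 3 * ?N\<^sup>2 / ((real \<Delta> - 1) ^ 3 * chi3 G) < ?N"
    by (simp only: pos_divide_less_eq[OF denom])
  also have "?N \<le> SDD (line_graph G)" unfolding assms(3) by (rule SDD_line_graph_ge[OF simple])
  finally show ?thesis .
qed

end
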